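(* Assume $a=\kappa$, so that the market price of interest rate risk is the constant $\lambda^r=\kappa(\bar r-b)/\sigma_r$. For given horizon $T>0$, let $g^r_s=\sigma_r\Psi(\kappa,T-s)$ for $0\le s\le T$. The extremal bond strategies on horizon $T$, i.e. the strategies $f^r$ maximizing or minimizing $$\mu_T=m^0_T+\lambda^r\int_0^T f^r_s\,ds-\frac12\int_0^T (f^r_s)^2\,ds$$ for a given value of $$\sigma_T^2=\int_0^T\left[\sigma_r\Psi(\kappa,T-s)+f^r_s\right]^2ds ,$$ are of the form $$f^r_s=\frac{\lambda^r+2\nu g^r_s}{1-2\nu}\qquad(0\le s\le T),$$ where the real number $\nu$ depends on the prescribed value of the variance $\sigma_T^2$ (the value $\sigma_T^2=0$ corresponding to the limit $\nu\to\pm\infty$, i.e. $f^r_s=-g^r_s$). The optimal bond strategies (those maximizing $\mu_T$ for the given value of $\sigma_T^2$) have $\nu<1/2$, and the bond strategies minimizing $\mu_T$ for the given value of $\sigma_T^2$ have $\nu>1/2$.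
   Context: Parameters: $\kappa,\bar r,b,r_0\in\mathbb{R}$ and $\sigma_r>0$. The function $\Psi$ is $\Psi(k,t)=\int_0^t e^{-ku}\,du$ (equal to $t$ if $k=0$ and to $\frac1k(1-e^{-kt})$ if $k\ne0$), and $m^0_T=T\bar r+(r_0-\bar r)\Psi(\kappa,T)$ is a constant not depending on the strategy. A (bond) strategy is a deterministic, sufficiently regular (e.g. continuous) function $f^r:[0,T]\to\mathbb{R}$, the exposure to interest rate risk, with no equity exposure. Background: the short rate satisfies $dr_t=\kappa(\bar r-r_t)dt+\sigma_r dW^r_t$, the portfolio value satisfies $dV_t/V_t=(r_t+f^r_t\lambda^r)dt+f^r_t dW^r_t$, and $\mu_T$ and $\sigma_T^2$ are the mean and variance of the normally distributed variable $\log(V_T/V_0)$. A bond strategy is called extremal if it maximizes or minimizes $\mu_T$ among all strategies with the same value of $\sigma_T^2$, and optimal if it maximizes $\mu_T$ among all strategies with the same value of $\sigma_T^2$. *)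

theory Defs
  imports "HOL-Analysis.Analysis"
begin

definition Psi :: "real \<Rightarrow> real \<Rightarrow> real" where
  "Psi k t = integral {0..t} (\<lambda>u. exp (- k * u))"

text \<open>
  Throughout, \<open>\<kappa>\<close>, \<open>rbar\<close>, \<open>\<sigma>\<close>, \<open>r0\<close> are the mean reversion speed, mean reversion level, volatility
  and initial value of the short rate \<open>dr = \<kappa> (rbar - r) dt + \<sigma> dW\<close>, and \<open>T\<close> is the horizon.
  The market price of interest rate risk is the constant to which it reduces when the mean
  reversion speed \<open>a\<close> used for pricing equals \<open>\<kappa>\<close>; \<open>b\<close> is the pricing counterpart of \<open>rbar\<close>.
\<close>

definition rate_price :: "real \<Rightarrow> real \<Rightarrow> real \<Rightarrow> real \<Rightarrow> real" where
  "rate_price \<kappa> rbar b \<sigma> = \<kappa> * (rbar - b) / \<sigma>"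

definition base_mean :: "real \<Rightarrow> real \<Rightarrow> real \<Rightarrow> real \<Rightarrow> real" where
  "base_mean \<kappa> rbar r0 T = T * rbar + (r0 - rbar) * Psi \<kappa> T"

definition rate_exposure :: "real \<Rightarrow> real \<Rightarrow> real \<Rightarrow> real \<Rightarrow> real" where
  "rate_exposure \<kappa> \<sigma> T s = \<sigma> * Psi \<kappa> (T - s)"

text \<open>
  A strategy is a continuous function on \<open>[0, T]\<close>; its values outside \<open>[0, T]\<close> are irrelevant.
\<close>

definition bond_strategy :: "real \<Rightarrow> (real \<Rightarrow> real) \<Rightarrow> bool" where
  "bond_strategy T f \<longleftrightarrow> continuous_on {0..T} f"

text \<open>
  Closed forms of the mean and variance of the normally distributed log-return
  \<open>log (V_T / V_0)\<close>, where \<open>dV / V = (r + f \<lambda>) dt + f dW\<close>. They are taken as definitions; the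
  stochastic model itself is not formalized.
\<close>

definition log_mean ::
  "real \<Rightarrow> real \<Rightarrow> real \<Rightarrow> real \<Rightarrow> real \<Rightarrow> real \<Rightarrow> (real \<Rightarrow> real) \<Rightarrow> real" where
  "log_mean \<kappa> rbar b r0 \<sigma> T f =
     base_mean \<kappa> rbar r0 T + rate_price \<kappa> rbar b \<sigma> * integral {0..T} f
       - 1 / 2 * integral {0..T} (\<lambda>s. (f s)\<^sup>2)"

definition log_variance :: "real \<Rightarrow> real \<Rightarrow> real \<Rightarrow> (real \<Rightarrow> real) \<Rightarrow> real" where
  "log_variance \<kappa> \<sigma> T f = integral {0..T} (\<lambda>s. (\<sigma> * Psi \<kappa> (T - s) + f s)\<^sup>2)"

definition optimal_strategy ::
  "real \<Rightarrow> real \<Rightarrow> real \<Rightarrow> real \<Rightarrow> real \<Rightarrow> real \<Rightarrow> (real \<Rightarrow> real) \<Rightarrow> bool" where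
  "optimal_strategy \<kappa> rbar b r0 \<sigma> T f \<longleftrightarrow> bond_strategy T f \<and>
     (\<forall>h. bond_strategy T h \<and> log_variance \<kappa> \<sigma> T h = log_variance \<kappa> \<sigma> T f \<longrightarrow>
        log_mean \<kappa> rbar b r0 \<sigma> T h \<le> log_mean \<kappa> rbar b r0 \<sigma> T f)"

definition minimizing_strategy ::
  "real \<Rightarrow> real \<Rightarrow> real \<Rightarrow> real \<Rightarrow> real \<Rightarrow> real \<Rightarrow> (real \<Rightarrow> real) \<Rightarrow> bool" where
  "minimizing_strategy \<kappa> rbar b r0 \<sigma> T f \<longleftrightarrow> bond_strategy T f \<and>
     (\<forall>h. bond_strategy T h \<and> log_variance \<kappa> \<sigma> T h = log_variance \<kappa> \<sigma> T f \<longrightarrow>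
        log_mean \<kappa> rbar b r0 \<sigma> T f \<le> log_mean \<kappa> rbar b r0 \<sigma> T h)"

definition extremal_strategy ::
  "real \<Rightarrow> real \<Rightarrow> real \<Rightarrow> real \<Rightarrow> real \<Rightarrow> real \<Rightarrow> (real \<Rightarrow> real) \<Rightarrow> bool" where
  "extremal_strategy \<kappa> rbar b r0 \<sigma> T f \<longleftrightarrow>
     optimal_strategy \<kappa> rbar b r0 \<sigma> T f \<or> minimizing_strategy \<kappa> rbar b r0 \<sigma> T f"

definition bond_form ::
  "real \<Rightarrow> real \<Rightarrow> real \<Rightarrow> real \<Rightarrow> real \<Rightarrow> real \<Rightarrow> real \<Rightarrow> real" where
  "bond_form \<kappa> rbar b \<sigma> T \<nu> s =
     (rate_price \<kappa> rbar b \<sigma> + 2 * \<nu> * rate_exposure \<kappa> \<sigma> T s) / (1 - 2 * \<nu>)"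

end

theory Submission
  imports Defs "HOL-Real_Asymp.Real_Asymp"
begin

text \<open>
  Write \<open>g\<close> for the rate exposure, \<open>\<lambda>\<close> for the market price of risk and \<open>u = f + g\<close>. Then the variance
  is \<open>\<integral>u\<^sup>2\<close>, and on strategies of equal variance the mean is, up to a constant, the linear functional
  \<open>\<integral>(\<lambda> + g) u\<close>. The proposed strategies are those with \<open>u = (\<lambda> + g) / (1 - 2 \<nu>)\<close>, and completing the
  square shows that such a strategy beats every other strategy \<open>h\<close> of the same variance by
  \<open>(1 - 2 \<nu>) / 2 * \<integral>(h - f)\<^sup>2\<close>. The sign of \<open>1 - 2 \<nu>\<close> then separates maximizers from minimizers.
\<close>

text \<open>Definiteness of the L2 norm on continuous functions. Equality cases of integral
  inequalities thereby become equality at every point of the interval, not merely almost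
  everywhere.\<close>

lemma integral_power2_eq_0_iff:
  fixes f :: "real \<Rightarrow> real"
  assumes "continuous_on {a..b} f" and "a < b"
  shows "integral {a..b} (\<lambda>x. (f x)\<^sup>2) = 0 \<longleftrightarrow> (\<forall>x\<in>{a..b}. f x = 0)"
proof -
  have "continuous_on {a..b} (\<lambda>x. (f x)\<^sup>2)"
    by (intro continuous_intros assms)
  from integral_eq_0_iff[OF this assms(2)] show ?thesis by simp
qed

section \<open>The function \<open>Psi\<close>, the rate exposure and admissible strategies\<close>

lemma Psi_0 [simp]: "Psi k 0 = 0"
  by (simp add: Psi_def)

lemma Psi_pos:
  assumes "t > 0"
  shows "Psi k t > 0"
proof -
  have c: "continuous_on {0..t} (\<lambda>u. exp (- k * u))"
    by (intro continuous_intros)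
  have "Psi k t \<ge> 0"
    unfolding Psi_def by (intro integral_nonneg integrable_continuous_interval c) auto
  moreover have "Psi k t \<noteq> 0"
    unfolding Psi_def using integral_eq_0_iff[OF c assms] assms by force
  ultimately show ?thesis by simp
qed

lemma continuous_on_Psi: "continuous_on {0..t} (Psi k)"
  unfolding Psi_def
  by (intro indefinite_integral_continuous_1 integrable_continuous_interval continuous_intros)

lemma continuous_on_rate_exposure: "continuous_on {0..T} (rate_exposure \<kappa> \<sigma> T)"
proof -
  have "continuous_on {0..T} (\<lambda>s. Psi \<kappa> (T - s))"
    by (intro continuous_on_compose2[OF continuous_on_Psi[of T \<kappa>]] continuous_intros) auto
  then show ?thesis
    unfolding rate_exposure_def by (intro continuous_intros)
qed

lemma bond_strategy_bond_form: "bond_strategy T (bond_form \<kappa> rbar b \<sigma> T \<nu>)"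
  \<comment> \<open>The denominator becomes a constant factor, so \<nu> = 1/2 needs no separate
    case: there division by zero makes \<open>bond_form\<close> the constant 0.\<close>
  unfolding bond_strategy_def bond_form_def divide_inverse
  by (intro continuous_intros continuous_on_rate_exposure)

text \<open>Strategies are functions on the whole real line, so uniqueness can hold only on
  \<open>{0..T}\<close>. This lemma and the next two carry properties between strategies that agree
  there.\<close>

lemma bond_strategy_cong:
  assumes "\<And>s. s \<in> {0..T} \<Longrightarrow> f s = h s"
  shows "bond_strategy T f \<longleftrightarrow> bond_strategy T h"
  unfolding bond_strategy_def using assms by (intro continuous_on_cong) auto

lemma log_variance_cong:
  assumes "\<And>s. s \<in> {0..T} \<Longrightarrow> f s = h s"
  shows "log_variance \<kappa> \<sigma> T f = log_variance \<kappa> \<sigma> T h"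
  unfolding log_variance_def using assms by (intro integral_cong) auto

lemma log_mean_cong:
  assumes "\<And>s. s \<in> {0..T} \<Longrightarrow> f s = h s"
  shows "log_mean \<kappa> rbar b r0 \<sigma> T f = log_mean \<kappa> rbar b r0 \<sigma> T h"
proof -
  have "integral {0..T} f = integral {0..T} h"
    using assms by (intro integral_cong) auto
  moreover have "integral {0..T} (\<lambda>s. (f s)\<^sup>2) = integral {0..T} (\<lambda>s. (h s)\<^sup>2)"
    using assms by (intro integral_cong) auto
  ultimately show ?thesis by (simp add: log_mean_def)
qed

lemma log_variance_eq_0_iff:
  assumes "bond_strategy T f" and "T > 0"
  shows "log_variance \<kappa> \<sigma> T f = 0 \<longleftrightarrow> (\<forall>s\<in>{0..T}. f s = - rate_exposure \<kappa> \<sigma> T s)"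
proof -
  have "continuous_on {0..T} (\<lambda>s. rate_exposure \<kappa> \<sigma> T s + f s)"
    using assms(1) unfolding bond_strategy_def
    by (intro continuous_intros continuous_on_rate_exposure)
  from integral_power2_eq_0_iff[OF this assms(2)] show ?thesis
    unfolding log_variance_def rate_exposure_def by (simp add: eq_neg_iff_add_eq_0 add.commute)
qed

text \<open>The variance of the constant strategy \<lambda>, which is the stated form at \<nu> = 0.
  The variance at any other \<nu> is a rescaling of it.\<close>

definition squared_price :: "real \<Rightarrow> real \<Rightarrow> real \<Rightarrow> real \<Rightarrow> real \<Rightarrow> real" where
  "squared_price \<kappa> rbar b \<sigma> T =
     integral {0..T} (\<lambda>s. (rate_price \<kappa> rbar b \<sigma> + rate_exposure \<kappa> \<sigma> T s)\<^sup>2)"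

text \<open>The exposure vanishes at the horizon but not at time \<open>0\<close>, so it cannot cancel the constant \<open>\<lambda>\<close>.\<close>

lemma squared_price_pos:
  assumes "\<sigma> > 0" and "T > 0"
  shows "squared_price \<kappa> rbar b \<sigma> T > 0"
proof -
  let ?p = "\<lambda>s. rate_price \<kappa> rbar b \<sigma> + rate_exposure \<kappa> \<sigma> T s"
  have c: "continuous_on {0..T} ?p"
    by (intro continuous_intros continuous_on_rate_exposure)
  have "?p 0 \<noteq> 0 \<or> ?p T \<noteq> 0"
    using Psi_pos[OF assms(2), of \<kappa>] assms(1) by (auto simp: rate_exposure_def)
  then have "squared_price \<kappa> rbar b \<sigma> T \<noteq> 0"
    unfolding squared_price_def using integral_power2_eq_0_iff[OF c assms(2)] assms(2) by force
  moreover have "squared_price \<kappa> rbar b \<sigma> T \<ge> 0"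
    unfolding squared_price_def
    by (intro integral_nonneg integrable_continuous_interval continuous_intros c) auto
  ultimately show ?thesis by simp
qed

lemma rate_exposure_add_bond_form:
  assumes "\<nu> \<noteq> 1 / 2"
  shows "rate_exposure \<kappa> \<sigma> T s + bond_form \<kappa> rbar b \<sigma> T \<nu> s
    = (rate_price \<kappa> rbar b \<sigma> + rate_exposure \<kappa> \<sigma> T s) / (1 - 2 * \<nu>)"
  using assms by (simp add: bond_form_def field_simps)

text \<open>Only the distance of \<nu> from 1/2 enters. When \<open>squared_price\<close> is
  positive, each positive variance therefore belongs to exactly two multipliers, symmetric about
  1/2: one for the maximum, one for the minimum.\<close>

lemma log_variance_bond_form:
  assumes "\<nu> \<noteq> 1 / 2"
  shows "log_variance \<kappa> \<sigma> T (bond_form \<kappa> rbar b \<sigma> T \<nu>)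
    = squared_price \<kappa> rbar b \<sigma> T / (1 - 2 * \<nu>)\<^sup>2"
  unfolding log_variance_def squared_price_def rate_exposure_def[symmetric]
    rate_exposure_add_bond_form[OF assms] power_divide
  by simp

text \<open>
  \<open>\<nu>\<close> is the Lagrange multiplier: the strategy of the stated form is the critical point of
  \<open>\<mu> + \<nu> \<sigma>\<^sup>2\<close>, whose quadratic part has the coefficient \<open>-(1 - 2 \<nu>) / 2\<close>.
\<close>

lemma lagrangian_gap:
  fixes \<kappa> rbar b \<sigma> :: real
  assumes f: "bond_strategy T f" and \<nu>: "\<nu> \<noteq> 1 / 2"
  defines "h \<equiv> bond_form \<kappa> rbar b \<sigma> T \<nu>"
  shows "(log_mean \<kappa> rbar b r0 \<sigma> T h + \<nu> * log_variance \<kappa> \<sigma> T h)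
      - (log_mean \<kappa> rbar b r0 \<sigma> T f + \<nu> * log_variance \<kappa> \<sigma> T f)
    = (1 - 2 * \<nu>) / 2 * integral {0..T} (\<lambda>s. (f s - h s)\<^sup>2)"
proof -
  define g where "g = rate_exposure \<kappa> \<sigma> T"
  define l where "l = rate_price \<kappa> rbar b \<sigma>"
  have cg: "continuous_on {0..T} g"
    unfolding g_def by (rule continuous_on_rate_exposure)
  have cf: "continuous_on {0..T} f"
    using f by (simp add: bond_strategy_def)
  have ch: "continuous_on {0..T} h"
    using bond_strategy_bond_form by (simp add: bond_strategy_def h_def)
  \<comment> \<open>Merging mean and variance into one integral reduces the comparison of
    \<open>h\<close> with \<open>f\<close> to their integrands; the constant
    \<open>base_mean\<close> cancels in the difference.\<close>
  have L: "((\<lambda>s. l * x s - 1 / 2 * (x s)\<^sup>2 + \<nu> * (g s + x s)\<^sup>2) has_integral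
      log_mean \<kappa> rbar b r0 \<sigma> T x + \<nu> * log_variance \<kappa> \<sigma> T x - base_mean \<kappa> rbar r0 T) {0..T}"
    if x: "continuous_on {0..T} x" for x
  proof -
    have "((\<lambda>s. l * x s - 1 / 2 * (x s)\<^sup>2 + \<nu> * (g s + x s)\<^sup>2) has_integral
        l * integral {0..T} x - 1 / 2 * integral {0..T} (\<lambda>s. (x s)\<^sup>2)
          + \<nu> * integral {0..T} (\<lambda>s. (g s + x s)\<^sup>2)) {0..T}"
      by (intro has_integral_add has_integral_diff has_integral_mult_right integrable_integral
          integrable_continuous_interval continuous_intros x cg)
    then show ?thesis
      unfolding log_mean_def log_variance_def g_def l_def rate_exposure_def
      by (simp add: algebra_simps)
  qed
  have pointwise: "(l * h s - 1 / 2 * (h s)\<^sup>2 + \<nu> * (g s + h s)\<^sup>2)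
      - (l * f s - 1 / 2 * (f s)\<^sup>2 + \<nu> * (g s + f s)\<^sup>2) = (1 - 2 * \<nu>) / 2 * (f s - h s)\<^sup>2" for s
  proof -
    \<comment> \<open>This is the first-order condition: the derivative
      \<open>l - x + 2 * \<nu> * (g s + x)\<close> of the integrand vanishes at
      \<open>x = h s\<close>. Substituting it for \<open>l\<close> removes the linear term in
      \<open>f s - h s\<close> and leaves a pure square.\<close>
    have "l = (1 - 2 * \<nu>) * h s - 2 * \<nu> * g s"
      using \<nu> by (simp add: h_def bond_form_def l_def g_def)
    then show ?thesis
      by (simp only:) (simp add: power2_eq_square field_simps)
  qed
  have "((\<lambda>s. (1 - 2 * \<nu>) / 2 * (f s - h s)\<^sup>2) has_integral
      (log_mean \<kappa> rbar b r0 \<sigma> T h + \<nu> * log_variance \<kappa> \<sigma> T h)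
        - (log_mean \<kappa> rbar b r0 \<sigma> T f + \<nu> * log_variance \<kappa> \<sigma> T f)) {0..T}"
    using has_integral_diff[OF L[OF ch] L[OF cf]] unfolding pointwise by (simp add: algebra_simps)
  from integral_unique[OF this] show ?thesis
    by simp
qed

section \<open>Comparing strategies of equal variance\<close>

lemma log_mean_gap:
  assumes "bond_strategy T f" and "\<nu> \<noteq> 1 / 2"
    and "log_variance \<kappa> \<sigma> T f = log_variance \<kappa> \<sigma> T (bond_form \<kappa> rbar b \<sigma> T \<nu>)"
  shows "log_mean \<kappa> rbar b r0 \<sigma> T (bond_form \<kappa> rbar b \<sigma> T \<nu>) - log_mean \<kappa> rbar b r0 \<sigma> T f
    = (1 - 2 * \<nu>) / 2 * integral {0..T} (\<lambda>s. (f s - bond_form \<kappa> rbar b \<sigma> T \<nu> s)\<^sup>2)"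
  using lagrangian_gap[OF assms(1,2), of \<kappa> rbar b r0 \<sigma>] assms(3) by simp

lemma integral_diff_bond_form:
  assumes "bond_strategy T f" and "T > 0"
  shows "integral {0..T} (\<lambda>s. (f s - bond_form \<kappa> rbar b \<sigma> T \<nu> s)\<^sup>2) \<ge> 0"
    and "integral {0..T} (\<lambda>s. (f s - bond_form \<kappa> rbar b \<sigma> T \<nu> s)\<^sup>2) = 0 \<longleftrightarrow>
      (\<forall>s\<in>{0..T}. f s = bond_form \<kappa> rbar b \<sigma> T \<nu> s)"
proof -
  have c: "continuous_on {0..T} (\<lambda>s. f s - bond_form \<kappa> rbar b \<sigma> T \<nu> s)"
    using assms(1) bond_strategy_bond_form[of T \<kappa> rbar b \<sigma> \<nu>] unfolding bond_strategy_def
    by (intro continuous_intros)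
  show "integral {0..T} (\<lambda>s. (f s - bond_form \<kappa> rbar b \<sigma> T \<nu> s)\<^sup>2) \<ge> 0"
    by (intro integral_nonneg integrable_continuous_interval continuous_intros c) auto
  show "integral {0..T} (\<lambda>s. (f s - bond_form \<kappa> rbar b \<sigma> T \<nu> s)\<^sup>2) = 0 \<longleftrightarrow>
      (\<forall>s\<in>{0..T}. f s = bond_form \<kappa> rbar b \<sigma> T \<nu> s)"
    using integral_power2_eq_0_iff[OF c assms(2)] by simp
qed

text \<open>The gap identity with the positive factor \<open>1 - 2 * \<nu>\<close> gives both
  directions: no competitor has a larger mean than \<open>h\<close>, and a competitor that is itself
  optimal forces the integral of the squared difference to vanish, hence agrees with
  \<open>h\<close>.\<close>

lemma optimal_strategy_iff_bond_form:
  fixes \<kappa> rbar b \<sigma> :: real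
  assumes "T > 0" and \<nu>: "\<nu> < 1 / 2"
  defines "h \<equiv> bond_form \<kappa> rbar b \<sigma> T \<nu>"
  shows "optimal_strategy \<kappa> rbar b r0 \<sigma> T f \<and> log_variance \<kappa> \<sigma> T f = log_variance \<kappa> \<sigma> T h
    \<longleftrightarrow> (\<forall>s\<in>{0..T}. f s = h s)"
proof
  assume f: "optimal_strategy \<kappa> rbar b r0 \<sigma> T f \<and> log_variance \<kappa> \<sigma> T f = log_variance \<kappa> \<sigma> T h"
  let ?I = "integral {0..T} (\<lambda>s. (f s - h s)\<^sup>2)"
  have bf: "bond_strategy T f"
    using f by (simp add: optimal_strategy_def)
  have "log_mean \<kappa> rbar b r0 \<sigma> T h \<le> log_mean \<kappa> rbar b r0 \<sigma> T f"
    using f bond_strategy_bond_form by (auto simp: optimal_strategy_def h_def)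
  then have "(1 - 2 * \<nu>) / 2 * ?I \<le> 0"
    using log_mean_gap[OF bf, of \<nu> \<kappa> \<sigma> rbar b r0] f \<nu> unfolding h_def by simp
  then have "?I \<le> 0"
    using \<nu> by (simp add: mult_le_0_iff)
  then show "\<forall>s\<in>{0..T}. f s = h s"
    using integral_diff_bond_form[OF bf assms(1), of \<kappa> rbar b \<sigma> \<nu>] unfolding h_def by linarith
next
  assume f: "\<forall>s\<in>{0..T}. f s = h s"
  have var: "log_variance \<kappa> \<sigma> T f = log_variance \<kappa> \<sigma> T h"
    and mean: "log_mean \<kappa> rbar b r0 \<sigma> T f = log_mean \<kappa> rbar b r0 \<sigma> T h"
    using f by (auto intro: log_variance_cong log_mean_cong)
  have "bond_strategy T f"
    using bond_strategy_cong[of T f h] f bond_strategy_bond_form by (simp add: h_def)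
  moreover have "log_mean \<kappa> rbar b r0 \<sigma> T x \<le> log_mean \<kappa> rbar b r0 \<sigma> T h"
    if x: "bond_strategy T x" "log_variance \<kappa> \<sigma> T x = log_variance \<kappa> \<sigma> T h" for x
  proof -
    have "(1 - 2 * \<nu>) / 2 * integral {0..T} (\<lambda>s. (x s - h s)\<^sup>2) \<ge> 0"
      using integral_diff_bond_form(1)[OF x(1) assms(1), of \<kappa> rbar b \<sigma> \<nu>] \<nu>
      unfolding h_def by (intro mult_nonneg_nonneg) auto
    then show ?thesis
      using log_mean_gap[OF x(1), of \<nu> \<kappa> \<sigma> rbar b r0] x(2) \<nu> unfolding h_def by simp
  qed
  ultimately show "optimal_strategy \<kappa> rbar b r0 \<sigma> T f \<and> log_variance \<kappa> \<sigma> T f = log_variance \<kappa> \<sigma> T h"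
    using var mean by (simp add: optimal_strategy_def)
qed

text \<open>The mirror image of the previous argument: for \<nu> > 1/2 the factor
  \<open>1 - 2 * \<nu>\<close> is negative and all inequalities between means reverse.\<close>

lemma minimizing_strategy_iff_bond_form:
  fixes \<kappa> rbar b \<sigma> :: real
  assumes "T > 0" and \<nu>: "\<nu> > 1 / 2"
  defines "h \<equiv> bond_form \<kappa> rbar b \<sigma> T \<nu>"
  shows "minimizing_strategy \<kappa> rbar b r0 \<sigma> T f \<and> log_variance \<kappa> \<sigma> T f = log_variance \<kappa> \<sigma> T h
    \<longleftrightarrow> (\<forall>s\<in>{0..T}. f s = h s)"
proof
  assume f: "minimizing_strategy \<kappa> rbar b r0 \<sigma> T f \<and> log_variance \<kappa> \<sigma> T f = log_variance \<kappa> \<sigma> T h"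
  let ?I = "integral {0..T} (\<lambda>s. (f s - h s)\<^sup>2)"
  have bf: "bond_strategy T f"
    using f by (simp add: minimizing_strategy_def)
  have "log_mean \<kappa> rbar b r0 \<sigma> T h \<ge> log_mean \<kappa> rbar b r0 \<sigma> T f"
    using f bond_strategy_bond_form by (auto simp: minimizing_strategy_def h_def)
  then have "(1 - 2 * \<nu>) / 2 * ?I \<ge> 0"
    using log_mean_gap[OF bf, of \<nu> \<kappa> \<sigma> rbar b r0] f \<nu> unfolding h_def by simp
  then have "?I \<le> 0"
    using \<nu> by (simp add: zero_le_mult_iff)
  then show "\<forall>s\<in>{0..T}. f s = h s"
    using integral_diff_bond_form[OF bf assms(1), of \<kappa> rbar b \<sigma> \<nu>] unfolding h_def by linarith
next
  assume f: "\<forall>s\<in>{0..T}. f s = h s"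
  have var: "log_variance \<kappa> \<sigma> T f = log_variance \<kappa> \<sigma> T h"
    and mean: "log_mean \<kappa> rbar b r0 \<sigma> T f = log_mean \<kappa> rbar b r0 \<sigma> T h"
    using f by (auto intro: log_variance_cong log_mean_cong)
  have "bond_strategy T f"
    using bond_strategy_cong[of T f h] f bond_strategy_bond_form by (simp add: h_def)
  moreover have "log_mean \<kappa> rbar b r0 \<sigma> T x \<ge> log_mean \<kappa> rbar b r0 \<sigma> T h"
    if x: "bond_strategy T x" "log_variance \<kappa> \<sigma> T x = log_variance \<kappa> \<sigma> T h" for x
  proof -
    have "(1 - 2 * \<nu>) / 2 * integral {0..T} (\<lambda>s. (x s - h s)\<^sup>2) \<le> 0"
      using integral_diff_bond_form(1)[OF x(1) assms(1), of \<kappa> rbar b \<sigma> \<nu>] \<nu>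
      unfolding h_def by (intro mult_nonpos_nonneg) auto
    then show ?thesis
      using log_mean_gap[OF x(1), of \<nu> \<kappa> \<sigma> rbar b r0] x(2) \<nu> unfolding h_def by simp
  qed
  ultimately show "minimizing_strategy \<kappa> rbar b r0 \<sigma> T f \<and> log_variance \<kappa> \<sigma> T f = log_variance \<kappa> \<sigma> T h"
    using var mean by (simp add: minimizing_strategy_def)
qed

section \<open>The degenerate variance zero and the limit of large multipliers\<close>

lemma extremal_zero_variance_iff:
  assumes "T > 0"
  shows "extremal_strategy \<kappa> rbar b r0 \<sigma> T f \<and> log_variance \<kappa> \<sigma> T f = 0 \<longleftrightarrow>
    (\<forall>s\<in>{0..T}. f s = - rate_exposure \<kappa> \<sigma> T s)"
proof
  assume "extremal_strategy \<kappa> rbar b r0 \<sigma> T f \<and> log_variance \<kappa> \<sigma> T f = 0"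
  then show "\<forall>s\<in>{0..T}. f s = - rate_exposure \<kappa> \<sigma> T s"
    using log_variance_eq_0_iff[OF _ assms]
    by (auto simp: extremal_strategy_def optimal_strategy_def minimizing_strategy_def)
next
  assume f: "\<forall>s\<in>{0..T}. f s = - rate_exposure \<kappa> \<sigma> T s"
  have "bond_strategy T (\<lambda>s. - rate_exposure \<kappa> \<sigma> T s)"
    unfolding bond_strategy_def by (intro continuous_intros continuous_on_rate_exposure)
  then have bf: "bond_strategy T f"
    using bond_strategy_cong[of T f] f by simp
  then have var: "log_variance \<kappa> \<sigma> T f = 0"
    using log_variance_eq_0_iff[OF _ assms] f by blast
  \<comment> \<open>Zero variance leaves a single competitor up to values outside
    \<open>{0..T}\<close>, so the inequality is an equality.\<close>
  have "log_mean \<kappa> rbar b r0 \<sigma> T x \<le> log_mean \<kappa> rbar b r0 \<sigma> T f"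
    if "bond_strategy T x" "log_variance \<kappa> \<sigma> T x = 0" for x
    using that f log_variance_eq_0_iff[OF that(1) assms] by (intro eq_refl log_mean_cong) auto
  then show "extremal_strategy \<kappa> rbar b r0 \<sigma> T f \<and> log_variance \<kappa> \<sigma> T f = 0"
    using bf var by (simp add: extremal_strategy_def optimal_strategy_def)
qed

lemma tendsto_affine_quotient:
  fixes l g :: real
  shows "((\<lambda>\<nu>. (l + 2 * \<nu> * g) / (1 - 2 * \<nu>)) \<longlongrightarrow> - g) at_top"
    and "((\<lambda>\<nu>. (l + 2 * \<nu> * g) / (1 - 2 * \<nu>)) \<longlongrightarrow> - g) at_bot"
proof -
  \<comment> \<open>Splitting \<open>l + 2 * \<nu> * g\<close> as
    \<open>(l + g) - (1 - 2 * \<nu>) * g\<close> isolates the limit. At \<nu> = 1/2 both quotients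
    are 0 by convention and the identity would read \<open>- g = 0\<close>, so that value is
    excluded.\<close>
  have eq: "\<forall>\<^sub>F \<nu> in F. (l + g) / (1 - 2 * \<nu>) - g = (l + 2 * \<nu> * g) / (1 - 2 * \<nu>)"
    if "\<forall>\<^sub>F \<nu> in F. \<nu> \<noteq> 1 / 2" for F
    using that by eventually_elim (simp add: field_simps)
  have not_half: "\<forall>\<^sub>F \<nu>::real in at_top. \<nu> \<noteq> 1 / 2" "\<forall>\<^sub>F \<nu>::real in at_bot. \<nu> \<noteq> 1 / 2"
    using eventually_gt_at_top[of "1 / 2 :: real"] eventually_gt_at_bot[of "1 / 2 :: real"]
    by (auto elim: eventually_mono)
  have "((\<lambda>\<nu>. (l + g) / (1 - 2 * \<nu>)) \<longlongrightarrow> 0) at_top"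
    by real_asymp
  from tendsto_diff[OF this tendsto_const[of g]]
  have "((\<lambda>\<nu>. (l + g) / (1 - 2 * \<nu>) - g) \<longlongrightarrow> - g) at_top"
    by simp
  then show "((\<lambda>\<nu>. (l + 2 * \<nu> * g) / (1 - 2 * \<nu>)) \<longlongrightarrow> - g) at_top"
    by (rule Lim_transform_eventually[OF _ eq[OF not_half(1)]])
  have "((\<lambda>\<nu>. (l + g) / (1 - 2 * \<nu>)) \<longlongrightarrow> 0) at_bot"
    by real_asymp
  from tendsto_diff[OF this tendsto_const[of g]]
  have "((\<lambda>\<nu>. (l + g) / (1 - 2 * \<nu>) - g) \<longlongrightarrow> - g) at_bot"
    by simp
  then show "((\<lambda>\<nu>. (l + 2 * \<nu> * g) / (1 - 2 * \<nu>)) \<longlongrightarrow> - g) at_bot"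
    by (rule Lim_transform_eventually[OF _ eq[OF not_half(2)]])
qed

theorem theorem3p1:
  fixes \<kappa> rbar b r0 \<sigma> T :: real
  assumes "\<sigma> > 0" and "T > 0"
  shows "(\<exists>\<nu>max \<nu>min :: real \<Rightarrow> real.
      (\<forall>v>0.
         (\<forall>f. extremal_strategy \<kappa> rbar b r0 \<sigma> T f \<and> log_variance \<kappa> \<sigma> T f = v \<longrightarrow>
            (\<exists>\<nu>\<in>{\<nu>max v, \<nu>min v}. \<forall>s\<in>{0..T}. f s = bond_form \<kappa> rbar b \<sigma> T \<nu> s)) \<and>
         \<nu>max v < 1 / 2 \<and>
         (\<forall>f. optimal_strategy \<kappa> rbar b r0 \<sigma> T f \<and> log_variance \<kappa> \<sigma> T f = v \<longleftrightarrow>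
            (\<forall>s\<in>{0..T}. f s = bond_form \<kappa> rbar b \<sigma> T (\<nu>max v) s)) \<and>
         \<nu>min v > 1 / 2 \<and>
         (\<forall>f. minimizing_strategy \<kappa> rbar b r0 \<sigma> T f \<and> log_variance \<kappa> \<sigma> T f = v \<longleftrightarrow>
            (\<forall>s\<in>{0..T}. f s = bond_form \<kappa> rbar b \<sigma> T (\<nu>min v) s))) \<and>
      filterlim \<nu>max at_bot (at_right 0) \<and>
      filterlim \<nu>min at_top (at_right 0)) \<and>
    (\<forall>f. extremal_strategy \<kappa> rbar b r0 \<sigma> T f \<and> log_variance \<kappa> \<sigma> T f = 0 \<longleftrightarrow>
       (\<forall>s\<in>{0..T}. f s = - rate_exposure \<kappa> \<sigma> T s)) \<and>
    (\<forall>s\<in>{0..T}.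
       ((\<lambda>\<nu>. bond_form \<kappa> rbar b \<sigma> T \<nu> s) \<longlongrightarrow> - rate_exposure \<kappa> \<sigma> T s) at_top \<and>
       ((\<lambda>\<nu>. bond_form \<kappa> rbar b \<sigma> T \<nu> s) \<longlongrightarrow> - rate_exposure \<kappa> \<sigma> T s) at_bot)"
proof -
  define P where "P = squared_price \<kappa> rbar b \<sigma> T"
  have P: "P > 0"
    unfolding P_def using assms by (rule squared_price_pos)
  \<comment> \<open>The two solutions of \<open>P / (1 - 2 * \<nu>)\<^sup>2 = v\<close>, from
    \<open>1 - 2 * \<nu> = sqrt (P / v)\<close> and its negative. As \<open>v\<close> decreases to 0
    the root tends to infinity, because \<open>P > 0\<close>.\<close>
  define \<nu>max where "\<nu>max v = (1 - sqrt (P / v)) / 2" for v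
  define \<nu>min where "\<nu>min v = (1 + sqrt (P / v)) / 2" for v
  have max_lim: "filterlim \<nu>max at_bot (at_right 0)"
    unfolding \<nu>max_def using P by real_asymp
  have min_lim: "filterlim \<nu>min at_top (at_right 0)"
    unfolding \<nu>min_def using P by real_asymp
  have max_lt: "\<nu>max v < 1 / 2" and min_gt: "\<nu>min v > 1 / 2" if "v > 0" for v
    using that P by (simp_all add: \<nu>max_def \<nu>min_def)
  have var: "log_variance \<kappa> \<sigma> T (bond_form \<kappa> rbar b \<sigma> T (\<nu>max v)) = v"
    "log_variance \<kappa> \<sigma> T (bond_form \<kappa> rbar b \<sigma> T (\<nu>min v)) = v" if "v > 0" for v
  proof -
    have "P / (1 - 2 * \<nu>max v)\<^sup>2 = v" "P / (1 - 2 * \<nu>min v)\<^sup>2 = v"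
      using that P by (simp_all add: \<nu>max_def \<nu>min_def field_simps)
    then show "log_variance \<kappa> \<sigma> T (bond_form \<kappa> rbar b \<sigma> T (\<nu>max v)) = v"
      "log_variance \<kappa> \<sigma> T (bond_form \<kappa> rbar b \<sigma> T (\<nu>min v)) = v"
      using max_lt[OF that] min_gt[OF that] by (simp_all add: log_variance_bond_form P_def)
  qed
  have opt: "optimal_strategy \<kappa> rbar b r0 \<sigma> T f \<and> log_variance \<kappa> \<sigma> T f = v \<longleftrightarrow>
      (\<forall>s\<in>{0..T}. f s = bond_form \<kappa> rbar b \<sigma> T (\<nu>max v) s)" if "v > 0" for v f
    using optimal_strategy_iff_bond_form[OF assms(2) max_lt[OF that], of \<kappa> rbar b r0 \<sigma> f]
      var(1)[OF that] by simp
  have min: "minimizing_strategy \<kappa> rbar b r0 \<sigma> T f \<and> log_variance \<kappa> \<sigma> T f = v \<longleftrightarrow>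
      (\<forall>s\<in>{0..T}. f s = bond_form \<kappa> rbar b \<sigma> T (\<nu>min v) s)" if "v > 0" for v f
    using minimizing_strategy_iff_bond_form[OF assms(2) min_gt[OF that], of \<kappa> rbar b r0 \<sigma> f]
      var(2)[OF that] by simp
  have ext: "\<exists>\<nu>\<in>{\<nu>max v, \<nu>min v}. \<forall>s\<in>{0..T}. f s = bond_form \<kappa> rbar b \<sigma> T \<nu> s"
    if "v > 0" "extremal_strategy \<kappa> rbar b r0 \<sigma> T f \<and> log_variance \<kappa> \<sigma> T f = v" for v f
    using that(2) opt[OF that(1), of f] min[OF that(1), of f]
    unfolding extremal_strategy_def by blast
  have lim: "((\<lambda>\<nu>. bond_form \<kappa> rbar b \<sigma> T \<nu> s) \<longlongrightarrow> - rate_exposure \<kappa> \<sigma> T s) at_top \<and>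
       ((\<lambda>\<nu>. bond_form \<kappa> rbar b \<sigma> T \<nu> s) \<longlongrightarrow> - rate_exposure \<kappa> \<sigma> T s) at_bot" for s
    unfolding bond_form_def by (intro conjI tendsto_affine_quotient)
  show ?thesis
    by (rule conjI[OF exI[of _ \<nu>max, OF exI[of _ \<nu>min]]];
      intro conjI allI impI ballI max_lim min_lim max_lt min_gt ext opt min
        extremal_zero_variance_iff[OF assms(2)] conjunct1[OF lim] conjunct2[OF lim]) auto
qed

end
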